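(* Let $m$, $n$ be positive integers such that $2\leq m\leq n$, and let $N=n-m+1$. Then $$\int_0^1 x^n \zeta(m,x)\,dx=\frac{n!}{\Gamma(m)}\left\{\frac{1}{N!}\sum_{k=1}^{N-1}(-1)^{k-1}\binom{N}{k}\left\{\psi(k+1)\,\zeta(-k)+\zeta'(-k)\right\}+\frac{\log(2\pi)-\gamma_E}{2\,N!}-\sum_{k=1}^{m-2}\frac{\Gamma(m-k)\,\zeta(m-k)}{(n-k+1)!}\right\}.$$
   Context: $\zeta(a,x)=\sum_{k=0}^\infty (k+x)^{-a}$ (for $\Re(a)>1$, $x>0$) is the Hurwitz zeta function; $\zeta(s)=\zeta(s,1)$ is the Riemann zeta function (analytically continued) and $\zeta'$ its derivative; $\psi(z)=\Gamma'(z)/\Gamma(z)$ is the digamma function; $\gamma_E$ is the Euler–Mascheroni constant. Empty sums (upper limit smaller than lower limit) equal $0$. *)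

theory Defs
  imports "HOL-Complex_Analysis.Complex_Analysis"
begin

text \<open>The series converges for \<open>Re a > 1\<close> and \<open>x > 0\<close>; outside this range the value is not meaningful.\<close>

definition hurwitz_zeta :: "complex \<Rightarrow> real \<Rightarrow> complex" where
  "hurwitz_zeta a x = (\<Sum>k. complex_of_real (real k + x) powr (-a))"

text \<open>The Riemann zeta function is the holomorphic continuation of \<open>\<zeta>(s, 1)\<close> from \<open>Re s > 1\<close>
  to the punctured plane, which is unique by the identity theorem. The condition \<open>f 1 = 0\<close> only fixes
  a dummy value at the pole, so that the function is uniquely determined on the whole type.\<close>

definition riemann_zeta :: "complex \<Rightarrow> complex" where
  "riemann_zeta = (THE f. f holomorphic_on (- {1}) \<and>
     (\<forall>s. Re s > 1 \<longrightarrow> f s = hurwitz_zeta s 1) \<and> f 1 = 0)"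

end

theory Submission
  imports Defs "HOL-Real_Asymp.Real_Asymp"
begin

text \<open>
  Write \<open>J n s\<close> for \<open>tail_moment n s = (\<Sum>k\<ge>1. \<integral>\<^sub>0\<^sup>1 x^n (k + x)^(-s) dx)\<close>. The integral in question is
  \<open>J n m + 1 / (n - m + 1)\<close>, the summand coming from the term \<open>x^(-m)\<close> of the Hurwitz series.
  Integration by parts gives \<open>(n + 1) J n s = \<zeta>(s) - 1 + s J (n + 1) (s + 1)\<close>, and \<open>J 0 s = 1 / (s - 1)\<close>.
  Telescoping yields, first for \<open>Re s > 1\<close>,
  \<open>(\<Sum>j<n. pochhammer s j / (j + 1)! \<zeta>(s + j)) + pochhammer s n / n! (J n (s + n) - 1 / (s - 1)) = 0\<close>.
  As \<open>J n\<close> is holomorphic for \<open>Re s > 1\<close>, this continues \<open>\<zeta>\<close> strip by strip to the plane and then holds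
  for \<open>Re s > 1 - n\<close>. Multiply by \<open>\<Gamma>(s)\<close> and let \<open>s \<rightarrow> m - n\<close>: the \<open>J\<close>-term converges, hence the
  simple poles of the terms \<open>\<Gamma>(s + j) \<zeta>(s + j)\<close> cancel, and comparing finite parts gives the formula. The
  cases \<open>n = 1, 2\<close> of the identity also provide the behaviour of \<open>\<zeta>\<close> at 1 and at 0, with the constant
  \<open>log (2\<pi>)\<close> entering through Wallis' product.
\<close>

subsection \<open>Moments of the Hurwitz series\<close>

definition unit_moment :: "nat \<Rightarrow> real \<Rightarrow> complex \<Rightarrow> complex" where
  "unit_moment n a s = integral {0..1} (\<lambda>x. of_real x ^ n * of_real (a + x) powr (-s))"

text \<open>The shifts start at 1, so that every integrand is continuous on the closed interval. The
  first summand \<open>x powr (-s)\<close> of the Hurwitz series is singular at 0 and is integrated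
  separately in \<open>moment_has_integral\<close>.\<close>

definition tail_moment :: "nat \<Rightarrow> complex \<Rightarrow> complex" where
  "tail_moment n s = (\<Sum>k. unit_moment n (real (Suc k)) s)"

lemma norm_of_real_powr: "x > 0 \<Longrightarrow> norm (complex_of_real x powr s) = x powr Re s"
  by (simp add: norm_powr_real_powr)

lemma continuous_on_unit_moment_integrand:
  assumes "a > 0"
  shows "continuous_on {0..1} (\<lambda>x::real. complex_of_real x ^ n * of_real (a + x) powr (-s))"
  using assms by (intro continuous_intros continuous_on_powr_complex)
     (auto simp: complex_nonpos_Reals_iff simp flip: of_real_add)

lemma unit_moment_has_integral:
  assumes "a > 0"
  shows "((\<lambda>x. of_real x ^ n * of_real (a + x) powr (-s)) has_integral unit_moment n a s) {0..1}"
  unfolding unit_moment_def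
  using integrable_continuous_interval[OF continuous_on_unit_moment_integrand[OF assms]]
  by blast

text \<open>This bound is uniform in \<open>x\<close> and on the half-plane
  \<open>Re s \<ge> c\<close>. It serves as a Weierstrass majorant twice: for series of functions of
  \<open>s\<close> and for series of functions of \<open>x\<close>.\<close>

lemma norm_unit_moment_integrand_le:
  assumes "a \<ge> 1" "c \<ge> 0" "c \<le> Re s" "x \<in> {0..1}"
  shows "norm (complex_of_real x ^ n * of_real (a + x) powr (-s)) \<le> a powr (-c)"
proof -
  have "norm (complex_of_real x ^ n * of_real (a + x) powr (-s)) = x ^ n * (a + x) powr (- Re s)"
    using assms by (simp add: norm_mult norm_power norm_of_real_powr del: of_real_add)
  also have "\<dots> \<le> 1 * (a + x) powr (- Re s)"
    using assms by (intro mult_right_mono power_le_one) auto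
  also have "\<dots> \<le> a powr (- Re s)"
    using assms by (auto intro!: powr_mono2')
  also have "\<dots> \<le> a powr (-c)"
    using assms by (intro powr_mono) auto
  finally show ?thesis .
qed

lemma norm_unit_moment_le:
  assumes "a \<ge> 1" "c \<ge> 0" "c \<le> Re s"
  shows "norm (unit_moment n a s) \<le> a powr (-c)"
proof -
  have "norm (unit_moment n a s) \<le> a powr (-c) * measure lborel (cbox (0::real) 1)"
    using norm_unit_moment_integrand_le[of a c s _ n] assms
      unit_moment_has_integral[of a n s]
    by (intro has_integral_bound[where f = "\<lambda>x. of_real x ^ n * of_real (a + x) powr (-s)"]) auto
  thus ?thesis by simp
qed

lemma unit_moment_holomorphic:
  assumes "a > 0"
  shows "unit_moment n a holomorphic_on UNIV"
proof -
  have "(\<lambda>s. integral (cbox 0 1) (\<lambda>x::real. complex_of_real x ^ n * of_real (a + x) powr (-s)))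
          holomorphic_on UNIV"
  proof (rule leibniz_rule_holomorphic[where fx =
        "\<lambda>s x. - (complex_of_real x ^ n * of_real (a + x) powr (-s) * Ln (of_real (a + x)))"])
    fix s :: complex and x :: real assume "x \<in> cbox 0 1"
    thus "((\<lambda>s. complex_of_real x ^ n * of_real (a + x) powr (-s)) has_field_derivative
           - (complex_of_real x ^ n * of_real (a + x) powr (-s) * Ln (of_real (a + x)))) (at s within UNIV)"
      using assms
      by (auto intro!: derivative_eq_intros simp: powr_def simp del: of_real_add)
  next
    show "(\<lambda>x::real. complex_of_real x ^ n * of_real (a + x) powr (-s)) integrable_on cbox 0 1" for s
      using unit_moment_has_integral[OF assms] by (auto simp: has_integral_integrable)
  next
    show "continuous_on (UNIV \<times> cbox 0 1)
        (\<lambda>(s, x). - (complex_of_real x ^ n * of_real (a + x) powr (-s) * Ln (of_real (a + x))))"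
      using assms unfolding split_beta
      by (intro continuous_intros continuous_on_powr_complex)
         (auto simp: complex_nonpos_Reals_iff simp flip: of_real_add)
  qed auto
  thus ?thesis by (simp add: unit_moment_def[abs_def])
qed

text \<open>Integration by parts, carried out as the fundamental theorem for
  \<open>x ^ Suc n * (a + x) powr (-s)\<close>, which vanishes at 0.\<close>

lemma unit_moment_rec:
  assumes "a > 0"
  shows "of_nat (Suc n) * unit_moment n a s =
         of_real (a + 1) powr (-s) + s * unit_moment (Suc n) a (s + 1)"
proof -
  have "((\<lambda>x. of_nat (Suc n) * (complex_of_real x ^ n * of_real (a + x) powr (-s))
           - s * (complex_of_real x ^ Suc n * of_real (a + x) powr (-(s+1)))) has_integral
        complex_of_real 1 ^ Suc n * of_real (a + 1) powr (-s) -
        complex_of_real 0 ^ Suc n * of_real (a + 0) powr (-s)) {0..1}"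
  proof (rule fundamental_theorem_of_calculus)
    fix x :: real assume x: "x \<in> {0..1}"
    have "((\<lambda>z. z ^ Suc n * (of_real a + z) powr (-s)) has_field_derivative
      of_nat (Suc n) * (complex_of_real x ^ n * of_real (a + x) powr (-s))
           - s * (complex_of_real x ^ Suc n * of_real (a + x) powr (-(s+1)))) (at (of_real x))"
    proof (rule DERIV_cong[OF DERIV_mult'])
      show "((\<lambda>z. z ^ Suc n) has_field_derivative of_nat (Suc n) * of_real x ^ n) (at (complex_of_real x))"
        by (rule derivative_eq_intros refl)+ simp
      show "((\<lambda>z. (of_real a + z) powr (-s)) has_field_derivative
              - (s * of_real (a + x) powr (-(s+1)))) (at (of_real x))"
        unfolding minus_add_distrib using assms x
        by (auto intro!: derivative_eq_intros simp: complex_nonpos_Reals_iff)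
    qed (simp add: algebra_simps)
    from has_vector_derivative_real_field[OF this]
    show "((\<lambda>x. complex_of_real x ^ Suc n * of_real (a + x) powr (-s)) has_vector_derivative
      of_nat (Suc n) * (complex_of_real x ^ n * of_real (a + x) powr (-s))
           - s * (complex_of_real x ^ Suc n * of_real (a + x) powr (-(s+1)))) (at x within {0..1})"
      by (simp add: o_def has_vector_derivative_at_within)
  qed auto
  moreover have "((\<lambda>x. of_nat (Suc n) * (complex_of_real x ^ n * of_real (a + x) powr (-s))
           - s * (complex_of_real x ^ Suc n * of_real (a + x) powr (-(s+1)))) has_integral
        of_nat (Suc n) * unit_moment n a s - s * unit_moment (Suc n) a (s + 1)) {0..1}"
    using assms by (intro has_integral_diff has_integral_mult_right unit_moment_has_integral)
  ultimately have "of_nat (Suc n) * unit_moment n a s - s * unit_moment (Suc n) a (s + 1) =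
     complex_of_real 1 ^ Suc n * of_real (a + 1) powr (-s) -
        complex_of_real 0 ^ Suc n * of_real (a + 0) powr (-s)"
    by (rule has_integral_unique[THEN sym])
  thus ?thesis by (simp add: algebra_simps)
qed

section \<open>Convergence, holomorphy and recurrence of the tail moments\<close>

lemma summable_Suc_powr:
  assumes "c > 1"
  shows "summable (\<lambda>k. real (Suc k) powr (-c))"
  by (subst summable_Suc_iff) (use assms in \<open>simp add: summable_real_powr_iff\<close>)

lemma summable_unit_moment:
  assumes "Re s > 1"
  shows "summable (\<lambda>k. unit_moment n (real (Suc k)) s)"
  using norm_unit_moment_le[of _ "Re s" s n] assms
  by (intro summable_comparison_test'[OF summable_Suc_powr[of "Re s"]]) auto

lemma tail_moment_holomorphic: "tail_moment n holomorphic_on {s. Re s > 1}"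
proof (rule holomorphic_uniform_sequence[where f = "\<lambda>K s. \<Sum>k<K. unit_moment n (real (Suc k)) s"])
  show "(\<lambda>s. \<Sum>k<K. unit_moment n (real (Suc k)) s) holomorphic_on {s. 1 < Re s}" for K
    using unit_moment_holomorphic[of "real (Suc _)" n]
    by (intro holomorphic_intros) (auto intro: holomorphic_on_subset)
next
  fix z assume z: "z \<in> {s. Re s > 1}"
  \<comment> \<open>Half the distance from \<open>z\<close> to the line \<open>Re s = 1\<close>: the
    closed disc of this radius stays in \<open>Re s \<ge> 1 + d\<close>.\<close>
  define d where "d = (Re z - 1) / 2"
  have d: "d > 0" using z by (simp add: d_def)
  have ge: "Re s \<ge> 1 + d" if "s \<in> cball z d" for s
  proof -
    have "Re z - Re s \<le> d"
      using that complex_Re_le_cmod[of "z - s"] by (simp add: dist_norm)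
    thus ?thesis by (simp add: d_def field_simps)
  qed
  have "uniform_limit (cball z d) (\<lambda>K s. \<Sum>k<K. unit_moment n (real (Suc k)) s)
          (\<lambda>s. \<Sum>k. unit_moment n (real (Suc k)) s) sequentially"
    using norm_unit_moment_le[of _ "1 + d" _ n] ge d
    by (intro Weierstrass_m_test[OF _ summable_Suc_powr[of "1 + d"]]) auto
  thus "\<exists>d>0. cball z d \<subseteq> {s. Re s > 1} \<and> uniform_limit (cball z d)
     (\<lambda>K s. \<Sum>k<K. unit_moment n (real (Suc k)) s) (tail_moment n) sequentially"
    using d ge by (intro exI[of _ d]) (force simp: tail_moment_def[abs_def])
qed (auto simp: open_halfspace_Re_gt)

lemma summable_hurwitz_zeta:
  assumes "Re s > 1" "x > 0"
  shows "summable (\<lambda>k. complex_of_real (real k + x) powr (-s))"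
proof (subst summable_Suc_iff[symmetric],
    rule summable_comparison_test'[OF summable_Suc_powr[of "Re s"]])
  fix k :: nat
  have "norm (complex_of_real (real (Suc k) + x) powr (-s)) = (real (Suc k) + x) powr (- Re s)"
    using assms by (simp add: norm_of_real_powr del: of_real_add)
  also have "\<dots> \<le> real (Suc k) powr (- Re s)"
    using assms by (intro powr_mono2') auto
  finally show "norm (complex_of_real (real (Suc k) + x) powr (-s)) \<le> real (Suc k) powr (- Re s)" .
qed (use assms in auto)

lemma hurwitz_zeta_Suc:
  assumes "Re s > 1" "x > 0"
  shows "hurwitz_zeta s x = of_real x powr (-s) + hurwitz_zeta s (x + 1)"
  using suminf_split_head[OF summable_hurwitz_zeta[OF assms]]
  by (simp add: hurwitz_zeta_def add_ac)

text \<open>Sum \<open>unit_moment_rec\<close> over all shifts; the boundary terms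
  \<open>(k + 2) powr (-s)\<close> add up to the zeta series without its first term 1.\<close>

lemma tail_moment_rec:
  assumes "Re s > 1"
  shows "of_nat (Suc n) * tail_moment n s =
    hurwitz_zeta s 1 - 1 + s * tail_moment (Suc n) (s + 1)"
proof -
  have 1: "(\<lambda>k. unit_moment n (real (Suc k)) s) sums tail_moment n s"
    unfolding tail_moment_def by (intro summable_sums summable_unit_moment assms)
  have 2: "(\<lambda>k. unit_moment (Suc n) (real (Suc k)) (s + 1)) sums tail_moment (Suc n) (s + 1)"
    unfolding tail_moment_def using assms by (intro summable_sums summable_unit_moment) auto
  have "(\<lambda>k. complex_of_real (real k + (1 + 1)) powr (-s)) sums hurwitz_zeta s (1 + 1)"
    unfolding hurwitz_zeta_def using assms by (intro summable_sums summable_hurwitz_zeta) auto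
  hence 3: "(\<lambda>k. complex_of_real (real (Suc k) + 1) powr (-s)) sums (hurwitz_zeta s 1 - 1)"
    using hurwitz_zeta_Suc[OF assms, of 1] by (simp add: add_ac)
  have "(\<lambda>k. of_nat (Suc n) * unit_moment n (real (Suc k)) s) sums
     (hurwitz_zeta s 1 - 1 + s * tail_moment (Suc n) (s + 1))"
    by (subst unit_moment_rec) (use sums_add[OF 3 sums_mult[OF 2, of s]] in auto)
  with sums_mult[OF 1, of "of_nat (Suc n)"] show ?thesis
    by (rule sums_unique2)
qed

text \<open>For \<open>n = 0\<close> the moments are integrals of \<open>t powr (-s)\<close> over
  the intervals from \<open>k + 1\<close> to \<open>k + 2\<close>, so their sum telescopes to the
  integral from 1 to infinity.\<close>

lemma tail_moment_0:
  assumes "Re s > 1"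
  shows "tail_moment 0 s = 1 / (s - 1)"
proof -
  have s: "s \<noteq> 1" using assms by auto
  have eq: "unit_moment 0 a s = of_real a powr (1 - s) / (s - 1) - of_real (a + 1) powr (1 - s) / (s - 1)"
    if "a > 0" for a
  proof -
    have "((\<lambda>x. complex_of_real x ^ 0 * of_real (a + x) powr (-s)) has_integral
        (- (of_real (a + 1) powr (1-s) / (s - 1))) - (- (of_real (a + 0) powr (1-s) / (s - 1)))) {0..1}"
    proof (rule fundamental_theorem_of_calculus)
      fix x :: real assume x: "x \<in> {0..1}"
      have "((\<lambda>z. - ((of_real a + z) powr (1-s) / (s - 1))) has_field_derivative
         complex_of_real x ^ 0 * of_real (a + x) powr (-s)) (at (of_real x))"
        using that x s
        by (auto intro!: derivative_eq_intros simp: complex_nonpos_Reals_iff divide_simps)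
           (auto simp: algebra_simps)
      from has_vector_derivative_real_field[OF this]
      show "((\<lambda>x. - (complex_of_real (a + x) powr (1-s) / (s - 1))) has_vector_derivative
         complex_of_real x ^ 0 * of_real (a + x) powr (-s)) (at x within {0..1})"
        by (simp add: o_def has_vector_derivative_at_within)
    qed auto
    with unit_moment_has_integral[OF that, of 0 s] show ?thesis
      by (auto dest: has_integral_unique)
  qed
  have lim: "(\<lambda>k. complex_of_real (real (Suc k)) powr (1 - s)) \<longlonglongrightarrow> 0"
  proof (rule tendsto_norm_zero_cancel)
    have "(\<lambda>k. real k powr (1 - Re s)) \<longlonglongrightarrow> 0"
      using assms by (intro tendsto_neg_powr filterlim_real_sequentially) auto
    from LIMSEQ_Suc[OF this]
    show "(\<lambda>k. norm (complex_of_real (real (Suc k)) powr (1 - s))) \<longlonglongrightarrow> 0"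
      by (subst norm_of_real_powr) auto
  qed
  have "(\<lambda>k. complex_of_real (real (Suc k)) powr (1 - s) / (s - 1) -
       complex_of_real (real (Suc (Suc k))) powr (1 - s) / (s - 1)) sums
       (complex_of_real (real (Suc 0)) powr (1 - s) / (s - 1) - 0 / (s - 1))"
    by (intro telescope_sums' tendsto_divide lim tendsto_const) (use s in auto)
  thus ?thesis
    unfolding tail_moment_def by (subst eq) (auto simp: sums_iff add_ac)
qed

text \<open>Subtracting \<open>q = 1 / (s - 1)\<close> absorbs the constant -1 of
  \<open>tail_moment_rec\<close>: \<open>(n + 1) * (J - q) = H + (s + n) * (T - q)\<close>.
  Iterating this from \<open>tail_moment 0 s - q = 0\<close> gives the sum.\<close>

lemma hurwitz_zeta_telescope:
  assumes "Re s > 1"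
  shows "(\<Sum>j<n. pochhammer s j / fact (Suc j) * hurwitz_zeta (s + of_nat j) 1) +
    pochhammer s n / fact n * (tail_moment n (s + of_nat n) - 1 / (s - 1)) = 0"
proof (induction n)
  case 0
  show ?case using assms by (simp add: tail_moment_0)
next
  case (Suc n)
  have s: "s \<noteq> 1" using assms by auto
  define T where "T = tail_moment (Suc n) (s + of_nat (Suc n))"
  define H where "H = hurwitz_zeta (s + of_nat n) 1"
  define J where "J = tail_moment n (s + of_nat n)"
  define p where "p = pochhammer s n / fact (Suc n)"
  have rec: "of_nat (Suc n) * J = H - 1 + (s + of_nat n) * T"
    unfolding H_def J_def T_def using assms tail_moment_rec[of "s + of_nat n" n]
    by (simp add: add_ac)
  have p: "pochhammer s n / fact n = of_nat (Suc n) * p"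
    by (simp add: p_def del: of_nat_Suc)
  have p': "pochhammer s (Suc n) / fact (Suc n) = (s + of_nat n) * p"
    by (simp add: p_def pochhammer_Suc)
  define q where "q = 1 / (s - 1)"
  have q: "(s - 1) * q = 1" using s by (simp add: q_def)
  have "p * H + (s + of_nat n) * p * (T - q) - of_nat (Suc n) * p * (J - q) =
        p * (H - 1 + (s + of_nat n) * T - of_nat (Suc n) * J) + p * (1 - (s - 1) * q)"
    by (simp add: algebra_simps)
  hence "p * H + (s + of_nat n) * p * (T - q) = of_nat (Suc n) * p * (J - q)"
    using rec q by simp
  moreover have "(\<Sum>j<n. pochhammer s j / fact (Suc j) * hurwitz_zeta (s + of_nat j) 1) +
      of_nat (Suc n) * p * (J - q) = 0"
    using Suc unfolding p J_def q_def .
  ultimately have "(\<Sum>j<n. pochhammer s j / fact (Suc j) * hurwitz_zeta (s + of_nat j) 1) +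
      p * H + (s + of_nat n) * p * (T - q) = 0"
    by (simp only: add.assoc)
  thus ?case
    unfolding sum.lessThan_Suc p' T_def q_def H_def p_def .
qed

subsection \<open>Analytic continuation of the zeta function\<close>

text \<open>
  The identity \<open>hurwitz_zeta_telescope\<close>, multiplied by \<open>s - 1\<close> and solved for its \<open>j = 0\<close> term,
  expresses \<open>f s = (s - 1) * hurwitz_zeta s 1\<close> through values of \<open>f\<close> to the right of \<open>s\<close>. The factor
  \<open>s + j - 1\<close> of \<open>pochhammer s j\<close> is absorbed into \<open>f (s + j)\<close>, so no poles arise.
\<close>

definition zeta_step :: "nat \<Rightarrow> (complex \<Rightarrow> complex) \<Rightarrow> complex \<Rightarrow> complex" where
  "zeta_step n f s =
     -((s - 1) * (\<Sum>j\<in>{1..<n}. pochhammer s (j - 1) / fact (Suc j) * f (s + of_nat j))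
       + pochhammer s n / fact n * ((s - 1) * tail_moment n (s + of_nat n) - 1))"

lemma zeta_step_eq:
  assumes "Re s > 1" "n \<ge> 1" and f: "\<And>z. Re z > 1 \<Longrightarrow> f z = (z - 1) * hurwitz_zeta z 1"
  shows "zeta_step n f s = (s - 1) * hurwitz_zeta s 1"
proof -
  have s: "s \<noteq> 1" using assms by auto
  define H where "H = (\<lambda>j. hurwitz_zeta (s + of_nat j) 1)"
  define T where "T = tail_moment n (s + of_nat n)"
  have "(\<Sum>j\<in>{1..<n}. pochhammer s (j - 1) / fact (Suc j) * f (s + of_nat j)) =
        (\<Sum>j\<in>{1..<n}. pochhammer s j / fact (Suc j) * H j)"
  proof (rule sum.cong)
    fix j assume "j \<in> {1..<n}"
    then obtain i where i: "j = Suc i" by (cases j) auto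
    show "pochhammer s (j - 1) / fact (Suc j) * f (s + of_nat j) = pochhammer s j / fact (Suc j) * H j"
      using assms(1) by (subst f) (auto simp: i H_def pochhammer_Suc simp del: fact_Suc)
  qed auto
  moreover have "(\<Sum>j<n. pochhammer s j / fact (Suc j) * H j) =
      H 0 + (\<Sum>j\<in>{1..<n}. pochhammer s j / fact (Suc j) * H j)"
    using assms(2) by (subst lessThan_atLeast0, subst sum.atLeast_Suc_lessThan) auto
  ultimately have "H 0 + (\<Sum>j\<in>{1..<n}. pochhammer s (j - 1) / fact (Suc j) * f (s + of_nat j)) +
      pochhammer s n / fact n * (T - 1 / (s - 1)) = 0"
    using hurwitz_zeta_telescope[OF assms(1), of n] by (simp add: H_def T_def)
  hence "(s - 1) * (H 0 + (\<Sum>j\<in>{1..<n}. pochhammer s (j - 1) / fact (Suc j) * f (s + of_nat j)) +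
      pochhammer s n / fact n * (T - 1 / (s - 1))) = 0" by simp
  hence "(s - 1) * H 0 + (s - 1) * (\<Sum>j\<in>{1..<n}. pochhammer s (j - 1) / fact (Suc j) * f (s + of_nat j)) +
      pochhammer s n / fact n * ((s - 1) * T - (s - 1) * (1 / (s - 1))) = 0"
    by (simp only: ring_distribs mult_ac)
  hence "(s - 1) * H 0 + (s - 1) * (\<Sum>j\<in>{1..<n}. pochhammer s (j - 1) / fact (Suc j) * f (s + of_nat j)) +
      pochhammer s n / fact n * ((s - 1) * T - 1) = 0"
    using s by simp
  hence "(s - 1) * H 0 = -((s - 1) * (\<Sum>j\<in>{1..<n}. pochhammer s (j - 1) / fact (Suc j) * f (s + of_nat j)) +
      pochhammer s n / fact n * ((s - 1) * T - 1))"
    by (simp only: add.assoc eq_neg_iff_add_eq_0)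
  thus ?thesis
    by (simp add: zeta_step_def H_def T_def)
qed

lemma holomorphic_on_shift:
  assumes "f holomorphic_on A" "\<And>s. s \<in> B \<Longrightarrow> s + c \<in> A"
  shows "(\<lambda>s. f (s + c)) holomorphic_on B"
  using assms by (intro holomorphic_on_compose_gen[of "\<lambda>s. s + c" B f A, unfolded o_def] holomorphic_intros) auto

lemma pochhammer_holomorphic: "(\<lambda>s::complex. pochhammer s n) holomorphic_on A"
  unfolding pochhammer_prod by (intro holomorphic_intros)

text \<open>The sum evaluates \<open>f\<close> at \<open>s + 1\<close> or further right, which gains
  one unit; the other bound keeps \<open>s + n\<close> where \<open>tail_moment n\<close> is
  holomorphic.\<close>

lemma zeta_step_holomorphic:
  assumes "f holomorphic_on {s. Re s > c}" "b \<ge> c - 1" "b \<ge> 1 - real n"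
  shows "zeta_step n f holomorphic_on {s. Re s > b}"
  unfolding zeta_step_def[abs_def] using assms(2,3)
  by (intro holomorphic_intros pochhammer_holomorphic holomorphic_on_shift[OF assms(1)]
        holomorphic_on_shift[OF tail_moment_holomorphic]) auto

text \<open>For \<open>c < 1\<close> this is the identity theorem on a connected half-plane; for
  \<open>c \<ge> 1\<close> the point already lies in the region of assumed equality.\<close>

lemma halfplane_continuation:
  assumes "f holomorphic_on {s. Re s > c}" "g holomorphic_on {s. Re s > c}"
    and "\<And>s. Re s > 1 \<Longrightarrow> f s = g s" "Re s > c"
  shows "f s = g s"
proof -
  have "f s = g s" if "c \<ge> 1" using assms that by auto
  moreover have "f s = g s" if "c < 1"
    by (rule analytic_continuation_open[of "{s. Re s > 1}" "{s. Re s > c}"])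
       (use that assms in \<open>auto simp: open_halfspace_Re_gt convex_halfspace_Re_gt intro!: convex_connected exI[of _ 2]\<close>)
  ultimately show ?thesis by linarith
qed

lemma zeta_continuation_halfplane:
  "\<exists>f. f holomorphic_on {s. Re s > - real M} \<and>
       (\<forall>s. Re s > 1 \<longrightarrow> f s = (s - 1) * hurwitz_zeta s 1)"
proof (induction M)
  case 0
  \<comment> \<open>With \<open>n = 1\<close> the sum in \<open>zeta_step\<close> is empty, so
    holomorphy rests on \<open>tail_moment 1\<close> alone.\<close>
  have "zeta_step 1 (\<lambda>s. (s - 1) * hurwitz_zeta s 1) holomorphic_on {s. Re s > - real 0}"
    by (auto simp: zeta_step_def[abs_def]
          intro!: holomorphic_intros holomorphic_on_shift[OF tail_moment_holomorphic])
  thus ?case using zeta_step_eq[of _ 1 "\<lambda>s. (s - 1) * hurwitz_zeta s 1"]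
    by (intro exI[of _ "zeta_step 1 (\<lambda>s. (s - 1) * hurwitz_zeta s 1)"]) simp
next
  case (Suc M)
  then obtain f where f: "f holomorphic_on {s. Re s > - real M}"
     "\<And>s. Re s > 1 \<Longrightarrow> f s = (s - 1) * hurwitz_zeta s 1" by auto
  \<comment> \<open>The index \<open>M + 2\<close> is chosen so that \<open>1 - n\<close> equals the
    new boundary \<open>- (M + 1)\<close>.\<close>
  have "zeta_step (M + 2) f holomorphic_on {s. Re s > - real (Suc M)}"
    by (rule zeta_step_holomorphic[OF f(1)]) auto
  thus ?case using zeta_step_eq[of _ "M + 2" f] f(2) by auto
qed

lemma zeta_continuation:
  "\<exists>f. f holomorphic_on UNIV \<and> (\<forall>s. Re s > 1 \<longrightarrow> f s = (s - 1) * hurwitz_zeta s 1)"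
proof -
  obtain F where F: "\<And>M. F M holomorphic_on {s. Re s > - real M}"
     "\<And>M s. Re s > 1 \<Longrightarrow> F M s = (s - 1) * hurwitz_zeta s 1"
    using zeta_continuation_halfplane by metis
  have le: "F M s = F M' s" if "M \<le> M'" "Re s > - real M" for M M' s
    by (rule halfplane_continuation[OF F(1)[of M] holomorphic_on_subset[OF F(1)[of M']]])
       (use that F(2) in auto)
  \<comment> \<open>Glue the continuations by using the first half-plane that contains
    \<open>s\<close>; by \<open>le\<close> any other one containing \<open>s\<close> gives the same
    value.\<close>
  define E where "E = (\<lambda>s. F (LEAST M. Re s > - real M) s)"
  have E: "E s = F M s" if "Re s > - real M" for s M
    unfolding E_def using that by (intro le Least_le LeastI[of "\<lambda>M. Re s > - real M"])
  have "E holomorphic_on (\<Union>M. {s. Re s > - real M})"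
  proof (rule holomorphic_on_UN_open)
    show "E holomorphic_on {s. Re s > - real M}" for M
      using F(1)[of M] by (rule holomorphic_transform) (use E in auto)
  qed (auto intro: open_halfspace_Re_gt)
  moreover have "(\<Union>M. {s. Re s > - real M}) = UNIV"
  proof -
    have "\<exists>M. Re s > - real M" for s
      using reals_Archimedean2[of "- Re s"] by (auto simp: neg_less_iff_less minus_less_iff)
    thus ?thesis by auto
  qed
  moreover have "E s = (s - 1) * hurwitz_zeta s 1" if "Re s > 1" for s
    using E[of 0 s] F(2)[of s 0] that by auto
  ultimately show ?thesis by auto
qed

section \<open>The Riemann zeta function and its product with \<open>s - 1\<close>\<close>

lemma riemann_zeta_properties:
  "riemann_zeta holomorphic_on (- {1})"
  "Re s > 1 \<Longrightarrow> riemann_zeta s = hurwitz_zeta s 1"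
  "riemann_zeta 1 = 0"
proof -
  define P where "P = (\<lambda>f. f holomorphic_on (- {1}) \<and>
     (\<forall>s. Re s > 1 \<longrightarrow> f s = hurwitz_zeta s 1) \<and> f 1 = 0)"
  obtain E where E: "E holomorphic_on UNIV" "\<And>s. Re s > 1 \<Longrightarrow> E s = (s - 1) * hurwitz_zeta s 1"
    using zeta_continuation by blast
  \<comment> \<open>Division by zero yields exactly the dummy value 0 at
    \<open>s = 1\<close>.\<close>
  have "P (\<lambda>s. E s / (s - 1))"
    unfolding P_def using E(2)
    by (auto intro!: holomorphic_intros holomorphic_on_subset[OF E(1)])
  moreover have "g = f" if "P f" "P g" for f g
  proof
    fix s show "g s = f s"
    proof (cases "s = 1")
      case False
      show ?thesis
        by (rule analytic_continuation_open[of "{s. Re s > 1}" "-{1}"])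
           (use False that in \<open>auto simp: P_def open_halfspace_Re_gt intro!: exI[of _ 2]
              connected_punctured_universe\<close>)
    qed (use that in \<open>auto simp: P_def\<close>)
  qed
  ultimately have "\<exists>!f. P f" by blast
  from theI'[OF this] have "P riemann_zeta" unfolding riemann_zeta_def P_def .
  thus "riemann_zeta holomorphic_on (- {1})"
    "Re s > 1 \<Longrightarrow> riemann_zeta s = hurwitz_zeta s 1" "riemann_zeta 1 = 0"
    by (auto simp: P_def)
qed

text \<open>The value at 1 is the residue of zeta there, which makes the product entire; Taylor
  coefficients of it replace Laurent coefficients of zeta.\<close>

definition entire_zeta :: "complex \<Rightarrow> complex" where
  "entire_zeta s = (if s = 1 then 1 else (s - 1) * riemann_zeta s)"

lemma riemann_zeta_conv_entire: "riemann_zeta s = entire_zeta s / (s - 1)"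
  using riemann_zeta_properties(3) by (auto simp: entire_zeta_def)

lemma entire_zeta_eq: "Re s > 1 \<Longrightarrow> entire_zeta s = (s - 1) * hurwitz_zeta s 1"
  using riemann_zeta_properties(2)[of s] by (auto simp: entire_zeta_def)

lemma entire_zeta_holomorphic: "entire_zeta holomorphic_on A"
proof -
  obtain E where E: "E holomorphic_on UNIV" "\<And>s. Re s > 1 \<Longrightarrow> E s = (s - 1) * hurwitz_zeta s 1"
    using zeta_continuation by blast
  \<comment> \<open>At \<open>s = 1\<close> all terms with the factor \<open>s - 1\<close> vanish,
    so the right-hand side can be read off as 1.\<close>
  have "E 1 = zeta_step 1 E 1"
  proof (rule halfplane_continuation[of E 0 "zeta_step 1 E" 1])
    show "zeta_step 1 E holomorphic_on {s. Re s > 0}"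
      by (rule zeta_step_holomorphic[of _ 0]) (auto intro: holomorphic_on_subset[OF E(1)])
    show "E s = zeta_step 1 E s" if "Re s > 1" for s
      using zeta_step_eq[of s 1 E] E(2) that by auto
  qed (auto intro: holomorphic_on_subset[OF E(1)])
  hence E1: "E 1 = 1" by (simp add: zeta_step_def)
  have "E s = (s - 1) * riemann_zeta s" if "s \<noteq> 1" for s
    by (rule analytic_continuation_open[of "{s. Re s > 1}" "-{1}"])
       (use that E(2) riemann_zeta_properties in \<open>auto simp: open_halfspace_Re_gt intro!: exI[of _ 2]
              connected_punctured_universe holomorphic_intros intro: holomorphic_on_subset[OF E(1)]\<close>)
  hence "entire_zeta = E"
    using E1 by (auto simp: entire_zeta_def fun_eq_iff)
  thus ?thesis using E(1) holomorphic_on_subset by blast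
qed

lemma entire_zeta_step:
  assumes "n \<ge> 1" "Re s > 1 - real n"
  shows "entire_zeta s = zeta_step n entire_zeta s"
proof (rule halfplane_continuation[of entire_zeta "1 - real n" "zeta_step n entire_zeta" s])
  show "zeta_step n entire_zeta holomorphic_on {s. Re s > 1 - real n}"
    by (rule zeta_step_holomorphic[OF entire_zeta_holomorphic, of "1 - real n"]) auto
qed (use assms zeta_step_eq[of _ n entire_zeta] in \<open>auto simp: entire_zeta_eq entire_zeta_holomorphic\<close>)

subsection \<open>The zeta function near 0 and 1\<close>

lemma of_real_powr_minus2: "x > 0 \<Longrightarrow> complex_of_real x powr (-2) = of_real (1 / x ^ 2)"
  by (simp add: powr_minus divide_inverse)

text \<open>Exponent 2 is singled out because \<open>zeta_step 1\<close> at \<open>s = 1\<close> and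
  \<open>zeta_step 2\<close> at \<open>s = 0\<close> both evaluate a tail moment at 2.\<close>

lemma unit_moment_2_eq:
  assumes "a > 0" and "((\<lambda>x. x ^ n / (a + x)\<^sup>2) has_integral I) {0..1}"
  shows "unit_moment n a 2 = of_real I"
proof -
  have "((\<lambda>x. complex_of_real (x ^ n / (a + x)\<^sup>2)) has_integral of_real I) {0..1}"
    using assms(2) by (rule has_integral_of_real)
  moreover have "((\<lambda>x. complex_of_real (x ^ n / (a + x)\<^sup>2)) has_integral unit_moment n a 2) {0..1}"
    by (rule has_integral_eq[OF _ unit_moment_has_integral[of a n 2]])
       (use assms(1) in \<open>auto simp: of_real_powr_minus2 simp del: of_real_add\<close>)
  ultimately show ?thesis by (rule has_integral_unique[THEN sym])
qed

lemma unit_moment_1_2: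
  assumes "a > 0"
  shows "unit_moment 1 a 2 = of_real (ln (a + 1) - ln a - 1 / (a + 1))"
proof (rule unit_moment_2_eq[OF assms])
  \<comment> \<open>The antiderivative comes from writing the numerator \<open>x\<close> as
    \<open>(a + x) - a\<close>.\<close>
  have "((\<lambda>x. x ^ 1 / (a + x)\<^sup>2) has_integral
     (ln (a + 1) + a / (a + 1)) - (ln (a + 0) + a / (a + 0))) {0..1}"
  proof (rule fundamental_theorem_of_calculus)
    fix x :: real assume x: "x \<in> {0..1}"
    hence pos: "a + x > 0" using assms by auto
    hence "((\<lambda>x. ln (a + x) + a / (a + x)) has_field_derivative 1 / (a + x) + - a / ((a + x) * (a + x)))
        (at x within {0..1})"
      by (auto intro!: derivative_eq_intros)
    also have "1 / (a + x) + - a / ((a + x) * (a + x)) = x ^ 1 / (a + x)\<^sup>2"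
      using pos by (simp add: divide_simps power2_eq_square)
    finally have "((\<lambda>x. ln (a + x) + a / (a + x)) has_field_derivative x ^ 1 / (a + x)\<^sup>2) (at x within {0..1})" .
    thus "((\<lambda>x. ln (a + x) + a / (a + x)) has_vector_derivative x ^ 1 / (a + x)\<^sup>2) (at x within {0..1})"
      by (simp add: has_real_derivative_iff_has_vector_derivative)
  qed auto
  moreover have "(ln (a + 1) + a / (a + 1)) - (ln (a + 0) + a / (a + 0)) = ln (a + 1) - ln a - 1 / (a + 1)"
    using assms by (simp add: divide_simps) (simp add: algebra_simps)
  ultimately show "((\<lambda>x. x ^ 1 / (a + x)\<^sup>2) has_integral ln (a + 1) - ln a - 1 / (a + 1)) {0..1}"
    by (simp only:)
qed

lemma unit_moment_2_2:
  assumes "a > 0"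
  shows "unit_moment 2 a 2 = of_real (1 - 2 * a * (ln (a + 1) - ln a) + a / (a + 1))"
proof (rule unit_moment_2_eq[OF assms])
  \<comment> \<open>Antiderivative obtained by expanding
    \<open>x\<^sup>2 = ((a + x) - a)\<^sup>2\<close> before dividing.\<close>
  define F where "F = (\<lambda>x. x - 2 * a * ln (a + x) - a\<^sup>2 / (a + x))"
  have "((\<lambda>x. x ^ 2 / (a + x)\<^sup>2) has_integral F 1 - F 0) {0..1}"
  proof (rule fundamental_theorem_of_calculus)
    fix x :: real assume x: "x \<in> {0..1}"
    hence pos: "a + x > 0" using assms by auto
    hence "(F has_field_derivative 1 - 2 * a * (1 / (a + x)) - (- a\<^sup>2 / ((a + x) * (a + x)))) (at x within {0..1})"
      unfolding F_def by (auto intro!: derivative_eq_intros)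
    also have "1 - 2 * a * (1 / (a + x)) - (- a\<^sup>2 / ((a + x) * (a + x))) = x ^ 2 / (a + x)\<^sup>2"
      using pos by (simp add: divide_simps power2_eq_square) (simp add: algebra_simps)
    finally have "(F has_field_derivative x ^ 2 / (a + x)\<^sup>2) (at x within {0..1})" .
    thus "(F has_vector_derivative x ^ 2 / (a + x)\<^sup>2) (at x within {0..1})"
      by (simp add: has_real_derivative_iff_has_vector_derivative)
  qed auto
  moreover have "F 1 - F 0 = 1 - 2 * a * (ln (a + 1) - ln a) + a / (a + 1)"
    using assms by (simp add: F_def divide_simps power2_eq_square) (simp add: algebra_simps)
  ultimately show "((\<lambda>x. x ^ 2 / (a + x)\<^sup>2) has_integral
      1 - 2 * a * (ln (a + 1) - ln a) + a / (a + 1)) {0..1}"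
    by simp
qed

text \<open>In the partial sums the logarithms telescope and the fractions form the harmonic sum
  without its first term, which leads to the defining limit of
  \<open>euler_mascheroni\<close>.\<close>

lemma tail_moment_1_2: "tail_moment 1 2 = of_real (1 - euler_mascheroni)"
proof -
  have sums: "(\<lambda>k. unit_moment 1 (real (Suc k)) 2) sums tail_moment 1 2"
    unfolding tail_moment_def by (intro summable_sums summable_unit_moment) auto
  define A where "A = (\<lambda>K. 1 - (harm (Suc K) - ln (real (Suc K))) :: real)"
  have "(\<Sum>k<K. unit_moment 1 (real (Suc k)) 2) = of_real (A K)" for K
  proof (induction K)
    case (Suc K)
    have "unit_moment 1 (real (Suc K)) 2 =
        of_real (ln (real (Suc (Suc K))) - ln (real (Suc K)) - 1 / real (Suc (Suc K)))"
      by (subst unit_moment_1_2) (simp_all add: add_ac)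
    also have "\<dots> = of_real (A (Suc K) - A K)"
      by (simp only: A_def of_real_eq_iff harm_Suc[of "Suc K"]) (simp add: inverse_eq_divide)
    finally show ?case using Suc
      by (simp only: sum.lessThan_Suc flip: of_real_add) simp
  qed (simp add: A_def harm_def)
  moreover have "(\<lambda>K. complex_of_real (A K)) \<longlonglongrightarrow> of_real (1 - euler_mascheroni)"
    unfolding A_def
    by (intro tendsto_of_real tendsto_diff tendsto_const LIMSEQ_Suc[OF euler_mascheroni_LIMSEQ])
  ultimately show ?thesis
    using sums unfolding sums_def by (auto intro: LIMSEQ_unique)
qed

section \<open>The constant in Stirling's formula via Wallis' product\<close>

lemma wallis_product_eq:
  "(\<Prod>k=1..n. (4 * real k ^ 2) / (4 * real k ^ 2 - 1)) =
     2 ^ (4 * n) * fact n ^ 4 / (fact (2 * n) ^ 2 * (2 * real n + 1))"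
proof (induction n)
  case (Suc n)
  have "(fact (2 * Suc n) :: real) = (2 * real n + 2) * (2 * real n + 1) * fact (2 * n)"
    by (simp add: algebra_simps)
  moreover have "(fact (Suc n) :: real) = (real n + 1) * fact n" by (simp add: algebra_simps)
  moreover have "4 * real (Suc n) ^ 2 - 1 = (2 * real n + 1) * (2 * real n + 3)"
    by (simp add: power2_eq_square algebra_simps)
  moreover have "(2::real) ^ (4 * Suc n) = 16 * 2 ^ (4 * n)" by (simp add: power_add)
  moreover have "2 * real (Suc n) + 1 = 2 * real n + 3" by simp
  ultimately have "2 ^ (4 * Suc n) * fact (Suc n) ^ 4 / (fact (2 * Suc n) ^ 2 * (2 * real (Suc n) + 1)) =
     (16 * 2 ^ (4 * n) * ((real n + 1) * fact n) ^ 4 / (((2 * real n + 2) * (2 * real n + 1) * fact (2 * n)) ^ 2 * (2 * real n + 3)) :: real)"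
    by (simp only:)
  also have "\<dots> = 2 ^ (4 * n) * fact n ^ 4 / (fact (2 * n) ^ 2 * (2 * real n + 1)) *
      (4 * real (Suc n) ^ 2 / ((2 * real n + 1) * (2 * real n + 3)))"
    by (simp add: power_mult_distrib divide_simps) (simp add: power4_eq_xxxx power2_eq_square algebra_simps)
  finally show ?case
    using Suc \<open>4 * real (Suc n) ^ 2 - 1 = _\<close> by simp
qed simp

text \<open>Given that the limit exists, compare the sequence at \<open>n\<close> and
  \<open>2 * n\<close>: in \<open>2 * D n - D (2 * n)\<close> the linear terms cancel, and what is
  left is the logarithm of the Wallis product up to an elementary factor.\<close>

lemma stirling_constant:
  assumes lim: "(\<lambda>n. real n + ln (fact n) - (real n + 1 / 2) * ln (real n)) \<longlonglongrightarrow> c"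
  shows "c = ln (2 * pi) / 2"
proof -
  define D where "D = (\<lambda>n. real n + ln (fact n) - (real n + 1 / 2) * ln (real n))"
  define P where "P = (\<lambda>n. \<Prod>k=1..n. (4 * real k ^ 2) / (4 * real k ^ 2 - 1))"
  have "(\<lambda>n. ln (P n) + ln (4 + 2 / real n)) \<longlonglongrightarrow> ln (pi / 2) + ln 4"
  proof (intro tendsto_add tendsto_ln)
    show "P \<longlonglongrightarrow> pi / 2" unfolding P_def by (rule wallis)
  qed (auto, real_asymp)
  moreover have "eventually (\<lambda>n. 2 * (2 * D n - D (2 * n)) = ln (P n) + ln (4 + 2 / real n)) sequentially"
    using eventually_gt_at_top[of 0]
  proof eventually_elim
    case (elim n)
    have "ln (P n) = 4 * real n * ln 2 + 4 * ln (fact n) - 2 * ln (fact (2 * n)) - ln (2 * real n + 1)"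
      unfolding P_def wallis_product_eq
      by (simp add: ln_div ln_mult ln_realpow del: fact_Suc)
    moreover have "4 + 2 / real n = 2 * ((2 * real n + 1) / real n)"
      using elim by (simp add: field_simps)
    hence "ln (4 + 2 / real n) = ln 2 + ln ((2 * real n + 1) / real n)"
      using elim by (simp only:) (subst ln_mult, auto)
    hence "ln (4 + 2 / real n) = ln 2 + ln (2 * real n + 1) - ln (real n)"
      using elim by (simp add: ln_div)
    moreover have "ln (real (2 * n)) = ln 2 + ln (real n)"
      using elim by (simp add: ln_mult)
    ultimately show ?case
      by (simp add: D_def field_simps)
  qed
  ultimately have "(\<lambda>n. 2 * (2 * D n - D (2 * n))) \<longlonglongrightarrow> ln (pi / 2) + ln 4"
    by (simp add: tendsto_cong)
  moreover have "(\<lambda>n. 2 * (2 * D n - D (2 * n))) \<longlonglongrightarrow> 2 * (2 * c - c)"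
  proof (intro tendsto_intros)
    show D: "D \<longlonglongrightarrow> c" using lim by (simp add: D_def)
    show "(\<lambda>n. D (2 * n)) \<longlonglongrightarrow> c"
      by (rule filterlim_compose[OF D]) (auto intro!: filterlim_subseq simp: strict_mono_def)
  qed
  ultimately have "2 * (2 * c - c) = ln (pi / 2) + ln 4" using LIMSEQ_unique by blast
  also have "\<dots> = ln (pi / 2 * 4)" by (subst ln_mult) auto
  finally show ?thesis by simp
qed

text \<open>Convergence of the series supplies the existence of the limit in Stirling's formula, and
  \<open>stirling_constant\<close> then supplies its value.\<close>

lemma tail_moment_2_2: "tail_moment 2 2 = of_real (ln (2 * pi) - 1 - euler_mascheroni)"
proof -
  have sums: "(\<lambda>k. unit_moment 2 (real (Suc k)) 2) sums tail_moment 2 2"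
    unfolding tail_moment_def by (intro summable_sums summable_unit_moment) auto
  define A where "A = (\<lambda>K. 2 * real K + 1 - harm (Suc K) - 2 * real K * ln (real (Suc K)) + 2 * ln (fact K) :: real)"
  have "(\<Sum>k<K. unit_moment 2 (real (Suc k)) 2) = of_real (A K)" for K
  proof (induction K)
    case (Suc K)
    have "unit_moment 2 (real (Suc K)) 2 =
        of_real (1 - 2 * real (Suc K) * (ln (real (Suc (Suc K))) - ln (real (Suc K))) + real (Suc K) / real (Suc (Suc K)))"
      by (subst unit_moment_2_2) (simp_all add: add_ac)
    moreover have "ln (fact (Suc K) :: real) = ln (real (Suc K)) + ln (fact K)"
      by (simp add: ln_mult del: of_nat_Suc)
    moreover have "real (Suc K) / real (Suc (Suc K)) = 1 - 1 / real (Suc (Suc K))"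
      by (simp add: divide_simps)
    moreover have "(harm (Suc (Suc K)) :: real) = harm (Suc K) + 1 / real (Suc (Suc K))"
      by (simp add: harm_Suc[of "Suc K"] inverse_eq_divide)
    ultimately have "unit_moment 2 (real (Suc K)) 2 = of_real (A (Suc K) - A K)"
      by (simp only: A_def of_real_eq_iff) (simp add: algebra_simps)
    thus ?case by (simp add: Suc del: of_nat_Suc)
  qed (simp add: A_def harm_def)
  hence "(\<lambda>K. complex_of_real (A K)) \<longlonglongrightarrow> tail_moment 2 2"
    using sums unfolding sums_def by simp
  moreover from tendsto_Re[OF this] have A: "A \<longlonglongrightarrow> Re (tail_moment 2 2)" by simp
  ultimately have L: "tail_moment 2 2 = of_real (Re (tail_moment 2 2))"
    using tendsto_of_real[OF A, where 'a = complex] LIMSEQ_unique by blast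
  define L where "L = Re (tail_moment 2 2)"
  \<comment> \<open>Adding these corrections cancels the harmonic number and replaces
    \<open>ln (n + 1)\<close> by \<open>ln n\<close>, so the sequence is exactly the one in
    \<open>stirling_constant\<close>.\<close>
  have "(\<lambda>n. (A n - 1 + (harm (Suc n) - ln (real (Suc n))) +
           (2 * real n + 1) * (ln (real (Suc n)) - ln (real n))) / 2)
      \<longlonglongrightarrow> (L - 1 + euler_mascheroni + 2) / 2"
  proof (intro tendsto_intros LIMSEQ_Suc[OF euler_mascheroni_LIMSEQ])
    show "A \<longlonglongrightarrow> L" using A by (simp add: L_def)
    show "(\<lambda>n. (2 * real n + 1) * (ln (real (Suc n)) - ln (real n))) \<longlonglongrightarrow> 2"
      by real_asymp
  qed auto
  hence "(\<lambda>n. real n + ln (fact n) - (real n + 1 / 2) * ln (real n)) \<longlonglongrightarrow> (L - 1 + euler_mascheroni + 2) / 2"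
    by (rule Lim_transform_eventually) (intro always_eventually allI, simp add: A_def field_simps)
  from stirling_constant[OF this] have "L = ln (2 * pi) - 1 - euler_mascheroni" by simp
  thus ?thesis using L by (simp add: L_def)
qed

section \<open>Values and first derivatives at 0 and 1\<close>

lemma entire_zeta_1: "entire_zeta 1 = 1"
  by (simp add: entire_zeta_def)

lemma entire_zeta_0: "entire_zeta 0 = 1 / 2"
  using entire_zeta_step[of 2 0] entire_zeta_1 by (simp add: zeta_step_def numeral_2_eq_2 pochhammer_Suc)

lemma entire_zeta_has_deriv: "(entire_zeta has_field_derivative deriv entire_zeta s) (at s)"
  using entire_zeta_holomorphic[of UNIV] by (auto intro: holomorphic_derivI)

lemma tail_moment_has_deriv:
  "Re s > 1 \<Longrightarrow> (tail_moment n has_field_derivative deriv (tail_moment n) s) (at s)"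
  using tail_moment_holomorphic[of n] open_halfspace_Re_gt[of 1] by (intro holomorphic_derivI) auto

text \<open>Near 1 the function equals \<open>zeta_step 1 entire_zeta\<close>, whose derivative
  there is \<open>1 - tail_moment 1 2\<close>. This is the constant term of the Laurent expansion of
  zeta at 1.\<close>

lemma deriv_entire_zeta_1: "deriv entire_zeta 1 = euler_mascheroni"
proof -
  have tm: "((\<lambda>s. tail_moment 1 (s + 1)) has_field_derivative deriv (tail_moment 1) 2) (at 1)"
    using DERIV_shift[of "tail_moment 1" "deriv (tail_moment 1) 2" 1 1] tail_moment_has_deriv[of 2 1]
    by simp
  have "zeta_step 1 entire_zeta = (\<lambda>s. -(s * ((s - 1) * tail_moment 1 (s + 1) - 1)))"
    by (simp add: zeta_step_def fun_eq_iff)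
  moreover have "((\<lambda>s. -(s * ((s - 1) * tail_moment 1 (s + 1) - 1))) has_field_derivative
      1 - tail_moment 1 2) (at 1)"
    by (rule derivative_eq_intros tm refl)+ simp
  ultimately have "(zeta_step 1 entire_zeta has_field_derivative 1 - tail_moment 1 2) (at 1)"
    by simp
  moreover have "eventually (\<lambda>s. s \<in> {s. Re s > 0}) (nhds (1::complex))"
    by (intro eventually_nhds_in_open) (auto simp: open_halfspace_Re_gt)
  hence "eventually (\<lambda>s. entire_zeta s = zeta_step 1 entire_zeta s) (nhds 1)"
    by eventually_elim (auto intro!: entire_zeta_step)
  ultimately have "(entire_zeta has_field_derivative 1 - tail_moment 1 2) (at 1)"
    by (subst DERIV_cong_ev[OF refl _ refl])
  thus ?thesis
    using tail_moment_1_2 by (simp add: DERIV_imp_deriv)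
qed

text \<open>Differentiating \<open>zeta_step 2 entire_zeta\<close> gives half of
  \<open>deriv entire_zeta 1 + tail_moment 2 2\<close>, in which the Euler-Mascheroni constants
  cancel.\<close>

lemma deriv_entire_zeta_0: "deriv entire_zeta 0 = (of_real (ln (2 * pi)) - 1) / 2"
proof -
  have tm: "((\<lambda>s. tail_moment 2 (s + 2)) has_field_derivative deriv (tail_moment 2) 2) (at 0)"
    using DERIV_shift[of "tail_moment 2" "deriv (tail_moment 2) 2" 0 2] tail_moment_has_deriv[of 2 2]
    by simp
  have ez: "((\<lambda>s. entire_zeta (s + 1)) has_field_derivative euler_mascheroni) (at 0)"
    using DERIV_shift[of entire_zeta "euler_mascheroni" 0 1] entire_zeta_has_deriv[of 1]
    by (simp add: deriv_entire_zeta_1)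
  define h :: complex where "h = 1 / 2"
  have "zeta_step 2 entire_zeta = (\<lambda>s. -((s - 1) * (h * entire_zeta (s + 1))
       + h * (s * (s + 1)) * ((s - 1) * tail_moment 2 (s + 2) - 1)))"
    by (simp add: zeta_step_def fun_eq_iff pochhammer_Suc numeral_2_eq_2 h_def)
  moreover have "((\<lambda>s. -((s - 1) * (h * entire_zeta (s + 1))
       + h * (s * (s + 1)) * ((s - 1) * tail_moment 2 (s + 2) - 1))) has_field_derivative
       (of_real (ln (2 * pi)) - 1) / 2) (at 0)"
    by (rule derivative_eq_intros tm ez refl)+
       (simp add: entire_zeta_1 tail_moment_2_2 h_def field_simps)
  ultimately have "(zeta_step 2 entire_zeta has_field_derivative (of_real (ln (2 * pi)) - 1) / 2) (at 0)"
    by simp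
  moreover have "eventually (\<lambda>s. s \<in> {s. Re s > -1}) (nhds (0::complex))"
    by (intro eventually_nhds_in_open) (auto simp: open_halfspace_Re_gt)
  hence "eventually (\<lambda>s. entire_zeta s = zeta_step 2 entire_zeta s) (nhds 0)"
    by eventually_elim (auto intro!: entire_zeta_step)
  ultimately have "(entire_zeta has_field_derivative (of_real (ln (2 * pi)) - 1) / 2) (at 0)"
    by (subst DERIV_cong_ev[OF refl _ refl])
  thus ?thesis by (rule DERIV_imp_deriv)
qed

lemma riemann_zeta_0: "riemann_zeta 0 = - 1 / 2"
  by (simp add: riemann_zeta_conv_entire entire_zeta_0)

lemma riemann_zeta_has_deriv:
  "s \<noteq> 1 \<Longrightarrow> (riemann_zeta has_field_derivative deriv riemann_zeta s) (at s)"
  using riemann_zeta_properties(1) by (intro holomorphic_derivI[of _ "-{1}"]) auto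

lemma deriv_riemann_zeta_0: "deriv riemann_zeta 0 = - of_real (ln (2 * pi)) / 2"
proof -
  have "((\<lambda>s. entire_zeta s / (s - 1)) has_field_derivative - of_real (ln (2 * pi)) / 2) (at 0)"
    by (rule derivative_eq_intros entire_zeta_has_deriv refl)+
       (simp_all add: entire_zeta_0 deriv_entire_zeta_0 field_simps)
  thus ?thesis
    by (simp add: riemann_zeta_conv_entire[abs_def] DERIV_imp_deriv)
qed

subsection \<open>Comparison of finite parts\<close>

text \<open>The continued telescoping identity times \<open>Gamma s\<close>, using
  \<open>Gamma s * pochhammer s j = Gamma (s + j)\<close>. Excluding integers avoids every pole of
  the factors.\<close>

lemma Gamma_zeta_moment_identity:
  assumes n: "n \<ge> 1" "Re s > 1 - real n" and s: "s \<notin> \<int>"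
  shows "Gamma (s + of_nat n) / fact n * (tail_moment n (s + of_nat n) - 1 / (s - 1)) =
    - (\<Sum>j<n. Gamma (s + of_nat j) * riemann_zeta (s + of_nat j) / fact (Suc j))"
proof -
  have "s + of_nat j \<notin> \<int>" for j using s by simp
  hence s1: "s + of_nat j \<noteq> 1" for j by (metis Ints_1)
  have "s \<noteq> 1" using s1[of 0] by simp
  have "s \<notin> \<int>\<^sub>\<le>\<^sub>0" using s by auto
  hence G: "Gamma s \<noteq> 0" "Gamma (s + of_nat j) = Gamma s * pochhammer s j" for j
    by (auto simp: Gamma_eq_zero_iff pochhammer_Gamma)
  define T where "T = tail_moment n (s + of_nat n)"
  define Z where "Z = (\<lambda>j. riemann_zeta (s + of_nat j))"
  define Q where "Q = pochhammer s n / fact n * (T - 1 / (s - 1))"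
  define S where "S = (\<Sum>j\<in>{1..<n}. pochhammer s j / fact (Suc j) * Z j)"
  have "(\<Sum>j\<in>{1..<n}. pochhammer s (j - 1) / fact (Suc j) * entire_zeta (s + of_nat j)) = S"
    unfolding S_def
  proof (rule sum.cong)
    fix j assume "j \<in> {1..<n}"
    then obtain i where i: "j = Suc i" by (cases j) auto
    show "pochhammer s (j - 1) / fact (Suc j) * entire_zeta (s + of_nat j) = pochhammer s j / fact (Suc j) * Z j"
      using s1[of j] by (simp add: entire_zeta_def i Z_def pochhammer_Suc del: fact_Suc)
  qed auto
  with entire_zeta_step[OF n] have "(s - 1) * Z 0 =
      -((s - 1) * S + pochhammer s n / fact n * ((s - 1) * T - 1))"
    using \<open>s \<noteq> 1\<close> by (simp add: zeta_step_def entire_zeta_def T_def Z_def del: fact_Suc)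
  also have "(s - 1) * T - 1 = (s - 1) * (T - 1 / (s - 1))"
    using \<open>s \<noteq> 1\<close> by (simp add: field_simps)
  also have "-((s - 1) * S + pochhammer s n / fact n * ((s - 1) * (T - 1 / (s - 1)))) = (s - 1) * (- S - Q)"
  proof -
    have "-(a * S + p * (a * q)) = a * (- S - p * q)" for a p q
      by (simp add: algebra_simps)
    thus ?thesis unfolding Q_def .
  qed
  finally have "(s - 1) * Z 0 = (s - 1) * (- S - Q)" .
  hence "Z 0 = - S - Q"
    using \<open>s \<noteq> 1\<close> by (metis mult_left_cancel right_minus_eq)
  hence "Q = - (Z 0 + S)" by simp
  also have "Z 0 + S = (\<Sum>j<n. pochhammer s j / fact (Suc j) * Z j)"
    unfolding S_def using n(1) by (subst lessThan_atLeast0, subst sum.atLeast_Suc_lessThan) auto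
  finally have "Gamma s * Q =
      - (Gamma s * (\<Sum>j<n. pochhammer s j / fact (Suc j) * Z j))" by simp
  thus ?thesis
    by (simp only: G(2) Q_def T_def Z_def sum_distrib_left times_divide_eq_left times_divide_eq_right mult.assoc)
qed

lemma eventually_not_Int: "eventually (\<lambda>w::complex. w \<notin> \<int>) (at 0)"
proof -
  have "eventually (\<lambda>w::complex. w \<in> ball 0 1 - {0}) (at 0)"
    by (rule eventually_at_in_open) auto
  thus ?thesis
    by eventually_elim (auto simp: Ints_def)
qed

text \<open>The function below is \<open>w * Gamma (w - k)\<close> with its removable singularity at \<open>0\<close> filled in.\<close>

lemma Gamma_residue_factor_deriv:
  "((\<lambda>w::complex. Gamma (w + 1) / pochhammer (w - of_nat k) k) has_field_derivative
     ((-1) ^ k / fact k * Digamma (of_nat (k + 1)))) (at 0) \<and>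
   pochhammer (- of_nat k :: complex) k = (-1) ^ k * fact k"
proof (induction k)
  case 0
  have "((\<lambda>w::complex. Gamma (w + 1)) has_field_derivative Digamma 1) (at 0)"
    by (auto intro!: derivative_eq_intros)
  thus ?case by simp
next
  case (Suc k)
  define f where "f = (\<lambda>w::complex. Gamma (w + 1) / pochhammer (w - of_nat k) k)"
  define c where "c = (-1) ^ k / (fact k :: complex)"
  have f: "(f has_field_derivative c * Digamma (of_nat (k + 1))) (at 0)"
    using Suc.IH by (simp add: f_def c_def)
  \<comment> \<open>The second conjunct of the induction hypothesis enters here: the value at 0 is
    the residue of \<open>Gamma\<close> at \<open>- k\<close>, which the quotient rule uses.\<close>
  have f0: "f 0 = c"
    using Suc.IH by (simp add: f_def c_def field_simps power_mult_distrib flip: power_add)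
  have rec: "pochhammer (w - of_nat (Suc k)) (Suc k) = (w - of_nat (Suc k)) * pochhammer (w - of_nat k) k"
    for w :: complex
    by (subst pochhammer_rec) simp
  have eq: "(\<lambda>w::complex. Gamma (w + 1) / pochhammer (w - of_nat (Suc k)) (Suc k)) =
      (\<lambda>w. f w / (w - of_nat (Suc k)))"
    unfolding rec f_def by (simp add: fun_eq_iff mult.commute)
  \<comment> \<open>The quotient rule, arranged so that \<open>1 / d\<close> joins the
    \<open>Digamma\<close> value and raises its argument by one.\<close>
  have quot: "(c * D * (0 - d) - c * 1) / ((0 - d) * (0 - d)) = - c / d * (D + 1 / d)"
    if "d \<noteq> 0" for c d D :: complex
    using that by (simp add: field_simps)
  have nz: "(of_nat (Suc k) :: complex) \<noteq> 0" by (rule of_nat_neq_0)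
  have "((\<lambda>w. f w / (w - of_nat (Suc k))) has_field_derivative
      (c * Digamma (of_nat (k + 1)) * (0 - of_nat (Suc k)) - f 0 * 1) /
        ((0 - of_nat (Suc k)) * (0 - of_nat (Suc k)))) (at 0)"
    by (rule derivative_eq_intros f refl)+ (use nz in \<open>simp_all del: of_nat_Suc\<close>)
  also have "(c * Digamma (of_nat (k + 1)) * (0 - of_nat (Suc k)) - f 0 * 1) /
        ((0 - of_nat (Suc k)) * (0 - of_nat (Suc k))) =
      - c / of_nat (Suc k) * (Digamma (of_nat (k + 1)) + 1 / of_nat (Suc k))"
    unfolding f0 by (rule quot[OF nz])
  also have "- c / of_nat (Suc k) = (-1) ^ Suc k / fact (Suc k)"
    by (simp add: c_def)
  also have "Digamma (of_nat (k + 1)) + 1 / of_nat (Suc k) = (Digamma (of_nat (Suc k + 1)) :: complex)"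
    using Digamma_plus1[OF nz] by (simp add: add_ac)
  finally have "((\<lambda>w::complex. Gamma (w + 1) / pochhammer (w - of_nat (Suc k)) (Suc k)) has_field_derivative
      (-1) ^ Suc k / fact (Suc k) * Digamma (of_nat (Suc k + 1))) (at 0)"
    unfolding eq .
  moreover have "pochhammer (- of_nat (Suc k) :: complex) (Suc k) = (-1) ^ Suc k * fact (Suc k)"
    using rec[of 0] Suc.IH by (simp add: algebra_simps)
  ultimately show ?case by blast
qed

text \<open>With \<open>g w = w * Gamma (w - k)\<close> continued to 0, the expression is the
  difference quotient at 0 of \<open>g w * f (w - k)\<close>; its limit is given by the product
  rule.\<close>

lemma Gamma_mult_finite_part:
  fixes f :: "complex \<Rightarrow> complex"
  assumes f: "(f has_field_derivative f') (at (- of_nat k))"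
  shows "((\<lambda>w. Gamma (w - of_nat k) * f (w - of_nat k) - (-1) ^ k / fact k * f (- of_nat k) / w) \<longlongrightarrow>
           (-1) ^ k / fact k * (Digamma (of_nat (k + 1)) * f (- of_nat k) + f')) (at 0)"
proof -
  define g where "g = (\<lambda>w::complex. Gamma (w + 1) / pochhammer (w - of_nat k) k)"
  define c where "c = (-1) ^ k / (fact k :: complex)"
  have g: "(g has_field_derivative c * Digamma (of_nat (k + 1))) (at 0)"
    and g0: "g 0 = c"
    using Gamma_residue_factor_deriv[of k] by (auto simp: g_def c_def field_simps simp flip: power_add)
  have f: "((\<lambda>w. f (w - of_nat k)) has_field_derivative f') (at 0)"
    using f DERIV_shift[of f f' 0 "- of_nat k"] by simp
  have "((\<lambda>w. g w * f (w - of_nat k)) has_field_derivative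
      c * (Digamma (of_nat (k + 1)) * f (- of_nat k) + f')) (at 0)"
    by (rule derivative_eq_intros f g refl)+ (simp add: g0 algebra_simps)
  hence "((\<lambda>w. (g w * f (w - of_nat k) - c * f (- of_nat k)) / w) \<longlongrightarrow>
      c * (Digamma (of_nat (k + 1)) * f (- of_nat k) + f')) (at 0)"
    by (simp add: has_field_derivative_iff g0)
  moreover have "eventually (\<lambda>w. (g w * f (w - of_nat k) - c * f (- of_nat k)) / w =
       Gamma (w - of_nat k) * f (w - of_nat k) - c * f (- of_nat k) / w) (at 0)"
    using eventually_not_Int
  proof eventually_elim
    case (elim w)
    have "w - of_nat k \<notin> \<int>"
      using elim Ints_add[of "w - of_nat k" "of_nat k"] by auto
    hence "w - of_nat k \<notin> \<int>\<^sub>\<le>\<^sub>0" by auto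
    hence G: "Gamma (w - of_nat k) \<noteq> 0" "Gamma (w - of_nat k + of_nat (Suc k)) =
        pochhammer (w - of_nat k) (Suc k) * Gamma (w - of_nat k)"
      by (auto simp: Gamma_eq_zero_iff pochhammer_Gamma)
    have "pochhammer (w - of_nat k) k \<noteq> 0"
      using \<open>w - of_nat k \<notin> \<int>\<close> unfolding pochhammer_eq_0_iff by (metis Ints_minus Ints_of_nat)
    hence "g w = w * Gamma (w - of_nat k)"
      using G(2) by (simp add: g_def pochhammer_Suc add_ac)
    moreover have "w \<noteq> 0" using elim by auto
    ultimately show ?case by (simp add: diff_divide_distrib)
  qed
  ultimately show ?thesis
    unfolding c_def by (rule Lim_transform_eventually)
qed

text \<open>At the pole of zeta the finite part is \<open>Digamma 1 + euler_mascheroni\<close>,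
  which is 0.\<close>

lemma Gamma_zeta_finite_part_1:
  "((\<lambda>w. Gamma (w + 1) * riemann_zeta (w + 1) - 1 / w) \<longlongrightarrow> 0) (at 0)"
proof -
  have ez: "((\<lambda>w. entire_zeta (w + 1)) has_field_derivative euler_mascheroni) (at 0)"
    using DERIV_shift[of entire_zeta "euler_mascheroni" 0 1] entire_zeta_has_deriv[of 1]
    by (simp add: deriv_entire_zeta_1)
  have g: "((\<lambda>w::complex. Gamma (w + 1)) has_field_derivative Digamma 1) (at 0)"
    by (auto intro!: derivative_eq_intros)
  have "((\<lambda>w. Gamma (w + 1) * entire_zeta (w + 1)) has_field_derivative 0) (at 0)"
    by (rule derivative_eq_intros ez g refl)+ (simp add: entire_zeta_1)
  hence "((\<lambda>w. (Gamma (w + 1) * entire_zeta (w + 1) - 1) / w) \<longlongrightarrow> 0) (at 0)"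
    by (simp add: has_field_derivative_iff entire_zeta_1)
  thus ?thesis
    by (rule Lim_transform_eventually)
       (auto simp: eventually_at_filter riemann_zeta_conv_entire diff_divide_distrib)
qed

lemma Gamma_zeta_tendsto:
  assumes "k \<ge> 2"
  shows "((\<lambda>w. Gamma (w + of_nat k) * riemann_zeta (w + of_nat k)) \<longlongrightarrow>
           Gamma (of_nat k) * riemann_zeta (of_nat k)) (at 0)"
proof -
  have "(of_nat k :: complex) \<noteq> 1" using assms by (metis of_nat_1 of_nat_eq_iff numeral_le_one_iff semiring_norm(69))
  moreover have "of_nat k \<notin> (\<int>\<^sub>\<le>\<^sub>0 :: complex set)"
    using assms by (simp add: of_nat_in_nonpos_Ints_iff)
  ultimately have "isCont (\<lambda>w. Gamma w * riemann_zeta w) (of_nat k)"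
    by (intro continuous_intros DERIV_isCont[OF riemann_zeta_has_deriv] DERIV_isCont[OF has_field_derivative_Gamma])
  hence "((\<lambda>w. Gamma w * riemann_zeta w) \<longlongrightarrow> Gamma (of_nat k) * riemann_zeta (of_nat k)) (at (of_nat k))"
    by (simp add: isCont_def)
  from LIM_offset_zero[OF this] show ?thesis by (simp add: add_ac)
qed

text \<open>Multiplying by \<open>w\<close> makes the constant \<open>A\<close> tend to 0, so
  \<open>A = 0\<close> and the given function is zero.\<close>

lemma pole_cancel:
  fixes A l :: complex
  assumes "((\<lambda>w. A / w) \<longlongrightarrow> l) (at 0)"
  shows "l = 0"
proof -
  have "((\<lambda>w. w * (A / w)) \<longlongrightarrow> 0 * l) (at 0)"
    by (intro tendsto_mult assms tendsto_ident_at)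
  hence "((\<lambda>w::complex. A) \<longlongrightarrow> 0 * l) (at 0)"
    by (rule Lim_transform_eventually) (auto simp: eventually_at_filter)
  hence "A = 0" by (simp add: tendsto_const_iff)
  thus ?thesis using assms by (simp add: tendsto_const_iff)
qed

section \<open>The integral expressed through a tail moment\<close>

lemma moment_has_integral:
  assumes "2 \<le> m" "m \<le> n"
  shows "((\<lambda>x::real. complex_of_real x ^ n * hurwitz_zeta (of_nat m) x) has_integral
           tail_moment n (of_nat m) + 1 / of_nat (n - m + 1)) {0..1}"
proof -
  define s where "s = complex_of_nat m"
  have s: "Re s > 1" using assms by (simp add: s_def)
  define u where "u = (\<lambda>k x. complex_of_real x ^ n * of_real (real (Suc k) + x) powr (-s))"
  \<comment> \<open>The series over shifts from 1 on converges uniformly in \<open>x\<close>, so it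
    may be integrated termwise.\<close>
  have "uniform_limit {0..1} (\<lambda>K x. \<Sum>k<K. u k x) (\<lambda>x. \<Sum>k. u k x) sequentially"
    using norm_unit_moment_integrand_le[of "real (Suc _)" "Re s" s _ n] s unfolding u_def
    by (intro Weierstrass_m_test[OF _ summable_Suc_powr[of "Re s"]]) auto
  moreover have "continuous_on {0..1} (\<lambda>x. \<Sum>k<K. u k x)" for K
    unfolding u_def by (intro continuous_on_sum continuous_on_unit_moment_integrand) auto
  ultimately obtain I J where IJ: "\<And>K. ((\<lambda>x. \<Sum>k<K. u k x) has_integral I K) {0..1}"
      "((\<lambda>x. \<Sum>k. u k x) has_integral J) {0..1}" "I \<longlonglongrightarrow> J"
    by (rule uniform_limit_integral) auto
  have "((\<lambda>x. \<Sum>k<K. u k x) has_integral (\<Sum>k<K. unit_moment n (real (Suc k)) s)) {0..1}" for K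
    unfolding u_def by (intro has_integral_sum unit_moment_has_integral) auto
  hence "I K = (\<Sum>k<K. unit_moment n (real (Suc k)) s)" for K
    by (rule has_integral_unique[OF IJ(1)])
  hence "I = (\<lambda>K. \<Sum>k<K. unit_moment n (real (Suc k)) s)" by (rule ext)
  hence "(\<lambda>K. \<Sum>k<K. unit_moment n (real (Suc k)) s) \<longlonglongrightarrow> J"
    using IJ(3) by simp
  hence J: "J = tail_moment n s"
    unfolding tail_moment_def by (simp add: sums_iff flip: sums_def)
  define p where "p = n - m"
  have "((\<lambda>x. x ^ Suc p / real (Suc p)) has_field_derivative x ^ p) (at x within {0..1})" for x :: real
    by (rule DERIV_cong[OF DERIV_cdivide[OF DERIV_pow]]) (simp del: of_nat_Suc)
  hence "((\<lambda>x::real. x ^ p) has_integral 1 ^ Suc p / real (Suc p) - 0 ^ Suc p / real (Suc p)) {0..1}"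
    by (intro fundamental_theorem_of_calculus) (auto simp flip: has_real_derivative_iff_has_vector_derivative)
  hence "((\<lambda>x. x ^ (n - m)) has_integral 1 / real (n - m + 1)) {0..1::real}"
    by (simp add: p_def add_ac)
  hence "((\<lambda>x. complex_of_real (x ^ (n - m))) has_integral of_real (1 / real (n - m + 1))) {0..1}"
    by (rule has_integral_of_real)
  from has_integral_add[OF IJ(2) this]
  have "((\<lambda>x. (\<Sum>k. u k x) + complex_of_real (x ^ (n - m))) has_integral
      tail_moment n s + 1 / of_nat (n - m + 1)) {0..1}"
    by (simp add: J)
  \<comment> \<open>The point 0 is left out as negligible: there \<open>powr\<close> returns 0,
    whereas \<open>x ^ (n - m)\<close> is 1 if \<open>n = m\<close>.\<close>
  moreover have "(\<Sum>k. u k x) + complex_of_real (x ^ (n - m)) = complex_of_real x ^ n * hurwitz_zeta (of_nat m) x"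
    if "x \<in> {0..1} - {0}" for x
  proof -
    have x: "x > 0" using that by auto
    have "(\<Sum>k. u k x) = complex_of_real x ^ n * hurwitz_zeta s (x + 1)"
      unfolding u_def hurwitz_zeta_def using summable_hurwitz_zeta[of s "x + 1"] s x
      by (subst suminf_mult) (auto simp: add_ac)
    moreover have "complex_of_real (x ^ (n - m)) = complex_of_real x ^ n * of_real x powr (-s)"
      using x assms by (simp add: s_def powr_minus power_diff divide_inverse)
    ultimately show ?thesis
      using hurwitz_zeta_Suc[OF s x] by (simp add: s_def algebra_simps)
  qed
  ultimately show ?thesis
    unfolding s_def by (rule_tac has_integral_spike_finite[of "{0}"]) (auto simp: eq_commute)
qed


section \<open>Evaluation of the integral by comparing finite parts\<close>

theorem theorem1:
  fixes m n N :: nat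
  assumes "2 \<le> m" and "m \<le> n" and "N = n - m + 1"
  shows "((\<lambda>x::real. complex_of_real x ^ n * hurwitz_zeta (of_nat m) x) has_integral
      (fact n / Gamma (of_nat m) *
        (1 / fact N *
           (\<Sum>k=1..N-1. (-1) ^ (k - 1) * of_nat (N choose k) *
              (Digamma (of_nat (k + 1)) * riemann_zeta (- of_nat k) + deriv riemann_zeta (- of_nat k)))
         + (complex_of_real (ln (2 * pi)) - euler_mascheroni) / (2 * fact N)
         - (\<Sum>k=1..m-2. Gamma (of_nat (m - k)) * riemann_zeta (of_nat (m - k)) / fact (n - k + 1)))))
      {0..1}"
proof -
  define I where "I = tail_moment n (of_nat m) + 1 / of_nat (n - m + 1)"
  define B :: "nat \<Rightarrow> complex" where
    "B = (\<lambda>k. Digamma (of_nat (k + 1)) * riemann_zeta (- of_nat k) + deriv riemann_zeta (- of_nat k))"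
  \<comment> \<open>Chosen so that \<open>s w + n = w + m\<close>: the tail moment at exponent
    \<open>m\<close> is reached as \<open>w\<close> tends to 0.\<close>
  define s where "s = (\<lambda>w::complex. w + of_nat m - of_nat n)"
  define t where "t = (\<lambda>j w. Gamma (s w + of_nat j) * riemann_zeta (s w + of_nat j) / fact (Suc j))"
  define low :: "nat \<Rightarrow> complex" where
    "low = (\<lambda>j. (-1) ^ (N - Suc j) / fact (N - Suc j) * B (N - Suc j) / fact (Suc j))"
  define high :: "nat \<Rightarrow> complex" where
    "high = (\<lambda>j. Gamma (of_nat (j - (N - 1))) * riemann_zeta (of_nat (j - (N - 1))) / fact (Suc j))"
  \<comment> \<open>Finite parts of \<open>t j\<close> at 0. The point \<open>s 0 + j\<close> is a
    pole of \<open>Gamma\<close> for \<open>j < N\<close>, the pole of zeta for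
    \<open>j = N\<close>, and an integer from 2 on, hence regular, for \<open>j > N\<close>.\<close>
  define c where "c = (\<lambda>j. if j < N then low j else if j = N then 0 else high j)"
  have N: "N \<ge> 1" "N < n" "n = m + N - 1" using assms by auto
  have s_eq: "s w = w - of_nat (N - 1)" for w
    using assms by (simp add: s_def of_nat_diff)
  \<comment> \<open>Only the sum of the residues enters later, so each \<open>r\<close> is merely
    asserted to exist.\<close>
  have "\<exists>r. ((\<lambda>w. t j w - r / w) \<longlongrightarrow> c j) (at 0)" for j
  proof -
    consider "j < N" | "j = N" | "j > N" by linarith
    thus ?thesis
    proof cases
      case 1
      define k where "k = N - Suc j"
      have sk: "s w + of_nat j = w - of_nat k" for w
        using 1 by (simp add: s_eq k_def of_nat_diff)
      have "(- of_nat k :: complex) \<noteq> 1"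
        by (metis add.commute add_eq_0_iff of_nat_Suc of_nat_neq_0)
      from tendsto_divide[OF Gamma_mult_finite_part[OF riemann_zeta_has_deriv[OF this]] tendsto_const fact_nonzero, of "Suc j"]
      have "((\<lambda>w. t j w - ((-1) ^ k / fact k * riemann_zeta (- of_nat k) / fact (Suc j)) / w) \<longlongrightarrow> c j) (at 0)"
        using 1 by (simp add: t_def sk c_def low_def B_def diff_divide_distrib mult_ac del: fact_Suc flip: k_def)
      thus ?thesis by blast
    next
      case 2
      have sk: "s w + of_nat j = w + 1" for w
        using 2 N by (simp add: s_eq of_nat_diff)
      from tendsto_divide[OF Gamma_zeta_finite_part_1 tendsto_const fact_nonzero, of "Suc j"]
      have "((\<lambda>w. t j w - (1 / fact (Suc j)) / w) \<longlongrightarrow> c j) (at 0)"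
        unfolding t_def sk using 2 by (simp add: c_def diff_divide_distrib mult_ac del: fact_Suc)
      thus ?thesis by blast
    next
      case 3
      define k where "k = j - (N - 1)"
      have sk: "s w + of_nat j = w + of_nat k" for w
        using 3 N by (simp add: s_eq k_def of_nat_diff)
      have "k \<ge> 2" using 3 N by (simp add: k_def)
      from tendsto_divide[OF Gamma_zeta_tendsto[OF this] tendsto_const fact_nonzero, of "Suc j"]
      have "((\<lambda>w. t j w - 0 / w) \<longlongrightarrow> c j) (at 0)"
        unfolding t_def sk c_def high_def k_def[symmetric] using 3 by (simp del: fact_Suc)
      thus ?thesis by blast
    qed
  qed
  then obtain r where r: "\<And>j. ((\<lambda>w. t j w - r j / w) \<longlongrightarrow> c j) (at 0)" by metis
  define L where "L = (\<lambda>w. Gamma (w + of_nat m) / fact n * (tail_moment n (w + of_nat m) - 1 / (s w - 1)))"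
  have L_lim: "(L \<longlongrightarrow> Gamma (of_nat m) / fact n * I) (at 0)"
  proof -
    \<comment> \<open>The sign turns \<open>- 1 / (s w - 1)\<close> into the summand
      \<open>1 / (n - m + 1)\<close> of \<open>I\<close> in the limit.\<close>
    have s0: "s 0 - 1 = - of_nat (n - m + 1)"
      using assms by (simp add: s_def of_nat_diff)
    have "(of_nat m :: complex) \<notin> \<int>\<^sub>\<le>\<^sub>0"
      using assms by (simp add: of_nat_in_nonpos_Ints_iff)
    hence "isCont L 0"
      unfolding L_def using s0 unfolding s_def
      by (intro continuous_intros isCont_o2[OF _ DERIV_isCont[OF has_field_derivative_Gamma]]
            isCont_o2[OF _ DERIV_isCont[OF tail_moment_has_deriv]])
         (use assms of_nat_neq_0[of "n - m", where 'a = complex] in \<open>auto simp del: of_nat_Suc\<close>)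
    moreover have "L 0 = Gamma (of_nat m) / fact n * I"
      unfolding L_def s0 I_def divide_minus_right by simp
    ultimately show ?thesis by (simp add: isCont_def)
  qed
  \<comment> \<open>This function has a finite limit but equals a pure pole
    \<open>(\<Sum>j<n. r j) / w\<close> near 0, so by \<open>pole_cancel\<close> the limit is
    0.\<close>
  have "((\<lambda>w. - L w - (\<Sum>j<n. t j w - r j / w)) \<longlongrightarrow>
          - (Gamma (of_nat m) / fact n * I) - (\<Sum>j<n. c j)) (at 0)"
    by (intro tendsto_diff tendsto_minus L_lim tendsto_sum r)
  moreover have "eventually (\<lambda>w. - L w - (\<Sum>j<n. t j w - r j / w) = (\<Sum>j<n. r j) / w) (at 0)"
  proof -
    \<comment> \<open>Radius 1 suffices for \<open>Re (s w) > 1 - n\<close> because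
      \<open>m \<ge> 2\<close>.\<close>
    have "eventually (\<lambda>w::complex. w \<in> ball 0 1) (at 0)"
      by (rule eventually_at_in_open') auto
    thus ?thesis using eventually_not_Int
    proof eventually_elim
      case (elim w)
      have "s w \<notin> \<int>" using elim by (simp add: s_eq)
      moreover have "\<bar>Re w\<bar> < 1"
        using elim abs_Re_le_cmod[of w] by simp
      hence "Re (s w) > 1 - real n" using assms by (simp add: s_def)
      ultimately have "L w = - (\<Sum>j<n. t j w)"
        using Gamma_zeta_moment_identity[of n "s w"] assms
        by (simp add: L_def t_def) (simp add: s_def)
      thus ?case by (simp add: sum_subtractf sum_divide_distrib)
    qed
  qed
  ultimately have "- (Gamma (of_nat m) / fact n * I) - (\<Sum>j<n. c j) = 0"
    by (rule pole_cancel[OF Lim_transform_eventually])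
  hence "Gamma (of_nat m) / fact n * I = - (\<Sum>j<n. c j)"
    by (metis minus_minus right_minus_eq)
  moreover have "Gamma (of_nat m :: complex) \<noteq> 0"
    using assms by (simp add: Gamma_eq_zero_iff of_nat_in_nonpos_Ints_iff)
  ultimately have I: "I = fact n / Gamma (of_nat m) * (- (\<Sum>j<n. c j))"
    by (metis (no_types) fact_nonzero nonzero_mult_div_cancel_left times_divide_eq_left times_divide_eq_right mult.commute)

  have "{..<n} = insert N ({..<N} \<union> {Suc N..<n})" using N by auto
  moreover have "sum c ({..<N} \<union> {Suc N..<n}) = sum c {..<N} + sum c {Suc N..<n}"
    by (rule sum.union_disjoint) auto
  ultimately have "(\<Sum>j<n. c j) = (\<Sum>j<N. c j) + c N + (\<Sum>j\<in>{Suc N..<n}. c j)"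
    by (simp add: add_ac)
  also have "(\<Sum>j\<in>{Suc N..<n}. c j) = (\<Sum>k=1..m-2. Gamma (of_nat (m - k)) * riemann_zeta (of_nat (m - k)) / fact (n - k + 1))"
  \<comment> \<open>With \<open>k = n - j\<close>, the range from \<open>N + 1\<close> to
    \<open>n - 1\<close> becomes 1 to \<open>m - 2\<close>, since
    \<open>n - N = m - 1\<close>.\<close>
  proof (rule sum.reindex_bij_witness[of _ "\<lambda>k. n - k" "\<lambda>j. n - j"])
    fix j assume j: "j \<in> {Suc N..<n}"
    hence "m - (n - j) = j - (N - 1)" "n - (n - j) + 1 = Suc j" using N by auto
    thus "Gamma (of_nat (m - (n - j))) * riemann_zeta (of_nat (m - (n - j))) / fact (n - (n - j) + 1) = c j"
      using j by (simp add: c_def high_def)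
  qed (use N in auto)
  also have "c N = 0" by (simp add: c_def)
  \<comment> \<open>Reversing the order makes \<open>k\<close> the index of the \<open>Gamma\<close>
    pole at \<open>- k\<close>.\<close>
  also have "(\<Sum>j<N. c j) = (\<Sum>k<N. low (N - Suc k))"
    by (subst sum.nat_diff_reindex) (simp add: c_def)
  also have "\<dots> = (\<Sum>k<N. (-1) ^ k * of_nat (N choose k) * B k / fact N)"
  proof (rule sum.cong)
    fix k assume "k \<in> {..<N}"
    hence k: "k < N" by simp
    have "N - Suc (N - Suc k) = k" "Suc (N - Suc k) = N - k" using k by auto
    hence "low (N - Suc k) = (-1) ^ k / fact k * B k / fact (N - k)"
      by (simp only: low_def)
    moreover have "of_nat (N choose k) = fact N / (fact k * fact (N - k) :: complex)"
      using k by (simp add: binomial_fact)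
    ultimately show "low (N - Suc k) = (-1) ^ k * of_nat (N choose k) * B k / fact N"
      by simp
  qed auto
  \<comment> \<open>The summand \<open>k = 0\<close> involves zeta at 0 and produces the constants
    \<open>ln (2 * pi)\<close> and \<open>euler_mascheroni\<close>.\<close>
  also have "{..<N} = insert 0 {1..N-1}" using N by auto
  also have "(\<Sum>k\<in>insert 0 {1..N-1}. (-1) ^ k * of_nat (N choose k) * B k / fact N) =
      B 0 / fact N + (\<Sum>k=1..N-1. (-1) ^ k * of_nat (N choose k) * B k / fact N)"
    by (subst sum.insert) auto
  also have "(\<Sum>k=1..N-1. (-1) ^ k * of_nat (N choose k) * B k / fact N) =
      - (1 / fact N * (\<Sum>k=1..N-1. (-1) ^ (k - 1) * of_nat (N choose k) * B k))"
    unfolding sum_distrib_left sum_negf[symmetric]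
  proof (rule sum.cong)
    fix k assume "k \<in> {1..N-1}"
    then obtain i where "k = Suc i" by (cases k) auto
    thus "(-1) ^ k * of_nat (N choose k) * B k / fact N =
        - (1 / fact N * ((-1) ^ (k - 1) * of_nat (N choose k) * B k))" by simp
  qed auto
  also have "B 0 = (euler_mascheroni - of_real (ln (2 * pi))) / 2"
    by (simp add: B_def riemann_zeta_0 deriv_riemann_zeta_0 field_simps)
  finally have "- (\<Sum>j<n. c j) =
      1 / fact N * (\<Sum>k=1..N-1. (-1) ^ (k - 1) * of_nat (N choose k) * B k)
         + (complex_of_real (ln (2 * pi)) - euler_mascheroni) / (2 * fact N)
         - (\<Sum>k=1..m-2. Gamma (of_nat (m - k)) * riemann_zeta (of_nat (m - k)) / fact (n - k + 1))"
    by (simp add: diff_divide_distrib)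
  with I moment_has_integral[OF assms(1,2)] show ?thesis
    by (simp only: I_def B_def)
qed

end
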